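(* Let $x$ be an infinite word over an arbitrary (possibly infinite) non-empty alphabet. Then at least one of the following holds: (a) for every integer $k\geq 1$, $x$ has a factor which is a $k$-power; or (b) for every integer $k\geq 1$, $x$ has a factor which is a $k$-anti-power.
   Context: A factor of a word $x$ is a finite block of consecutive letters of $x$. For an integer $k\geq1$, a $k$-power (power of order $k$) is a word of the form $u^k=uu\cdots u$ ($k$ copies) with $u$ a non-empty finite word. A $k$-anti-power (anti-power of order $k$) is a word of the form $u_1u_2\cdots u_k$ where $u_1,\ldots,u_k$ are non-empty words all of the same length and pairwise distinct. *)

theory Defs
  imports Main "HOL-Library.Omega_Words_Fun"
begin

text \<open>
  Finite words are lists and infinite words are one-sided, \<^typ>\<open>'a word\<close> being
  \<^typ>\<open>nat \<Rightarrow> 'a\<close>. The alphabet is the type variable: it is non-empty because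
  every type is, and it is not assumed to be finite. The term
  \<^term>\<open>x [i \<rightarrow> j]\<close> is the list of the letters of \<^term>\<open>x\<close> at
  the positions from \<^term>\<open>i\<close> up to but excluding \<^term>\<open>j\<close>.
\<close>

definition factor :: "'a list \<Rightarrow> 'a word \<Rightarrow> bool" where
  "factor w x \<longleftrightarrow> (\<exists>i j. i \<le> j \<and> w = x [i \<rightarrow> j])"

definition is_power :: "nat \<Rightarrow> 'a list \<Rightarrow> bool" where
  "is_power k w \<longleftrightarrow> (\<exists>u. u \<noteq> [] \<and> w = concat (replicate k u))"

definition is_anti_power :: "nat \<Rightarrow> 'a list \<Rightarrow> bool" where
  "is_anti_power k w \<longleftrightarrow>
     (\<exists>us. length us = k \<and> distinct us \<and>
        (\<forall>u\<in>set us. u \<noteq> []) \<and>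
        (\<forall>u\<in>set us. \<forall>v\<in>set us. length u = length v) \<and>
        w = concat us)"

end

theory Submission
  imports Defs
begin

text \<open>
  Suppose that \<^term>\<open>x\<close> has no \<^term>\<open>k\<close>-anti-power. Cutting a prefix into \<^term>\<open>k\<close> blocks of
  length \<^term>\<open>m\<close>, two blocks with indices \<^term>\<open>a < b\<close> coincide. Among the block lengths in a window
  of more than \<^term>\<open>k^2\<close> large consecutive integers, two, \<^term>\<open>m < n\<close>, yield the same pair
  \<^term>\<open>(a, b)\<close>. As \<^term>\<open>n - m\<close> is small, the blocks with index \<^term>\<open>a\<close> for the two lengths overlap
  in a long word. That word reappears shifted by \<^term>\<open>(b - a) * m\<close> and by \<^term>\<open>(b - a) * n\<close>, hence
  overlaps itself with the bounded shift \<^term>\<open>(b - a) * (n - m)\<close>. This forces a long run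
  with a bounded period, so powers of every order.
\<close>

lemma subsequence_join:
  assumes "i \<le> j" "j \<le> k"
  shows "x [i \<rightarrow> j] @ x [j \<rightarrow> k] = x [i \<rightarrow> k]"
  using assms upt_add_eq_append [of i j "k - j"]
  by (simp add: subsequence_def flip: map_append)

lemma concat_consecutive_blocks:
  "concat (map (\<lambda>i. x [i * m \<rightarrow> Suc i * m]) [0..<k]) = x [0 \<rightarrow> k * m]"
proof (induction k)
  case (Suc k)
  have "x [0 \<rightarrow> k * m] @ x [k * m \<rightarrow> Suc k * m] = x [0 \<rightarrow> Suc k * m]"
    by (simp add: subsequence_join)
  with Suc show ?case by simp
qed simp

lemma equal_blocks_if_no_anti_power:
  assumes no_anti: "\<nexists>w. factor w x \<and> is_anti_power k w" and "0 < m"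
  obtains a b where "a < b" "b < k" "\<And>t. t < m \<Longrightarrow> x (a * m + t) = x (b * m + t)"
proof -
  define B where "B i = x [i * m \<rightarrow> Suc i * m]" for i
  have B_map: "B i = map (\<lambda>t. x (i * m + t)) [0..<m]" for i
    by (simp add: B_def subsequence_def map_add_upt [symmetric] add.commute comp_def)
  have len: "length (B i) = m" for i by (simp add: B_map)
  have "\<not> inj_on B {..<k}"
  proof
    assume inj: "inj_on B {..<k}"
    have "is_anti_power k (x [0 \<rightarrow> k * m])"
      unfolding is_anti_power_def
    proof (intro exI conjI)
      show "distinct (map B [0..<k])"
        using inj by (simp add: distinct_map lessThan_atLeast0)
      show "\<forall>u\<in>set (map B [0..<k]). u \<noteq> []"
        using len \<open>0 < m\<close> by (auto simp flip: length_greater_0_conv)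
      show "x [0 \<rightarrow> k * m] = concat (map B [0..<k])"
        unfolding B_def by (rule concat_consecutive_blocks [symmetric])
    qed (auto simp: len)
    with no_anti show False by (auto simp: factor_def)
  qed
  then obtain a b where "a < b" "b < k" "B a = B b"
    by (auto simp: inj_on_def) (metis linorder_neqE_nat)
  then show thesis by (intro that [of a b]) (auto simp: B_map)
qed

lemma power_if_periodic:
  assumes "\<And>s. p \<le> s \<Longrightarrow> s < p + l * d \<Longrightarrow> x s = x (s + d)"
  shows "concat (replicate l (x [p \<rightarrow> p + d])) = x [p \<rightarrow> p + l * d]"
  using assms
proof (induction l)
  case (Suc l)
  note periodic = Suc.prems
  \<comment> \<open>Going back \<open>d\<close> letters at a time leads from block \<open>j\<close>
    to the first block; \<open>j = l\<close> is the block to be appended.\<close>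
  have "x (p + j * d + t) = x (p + t)" if "j \<le> l" "t < d" for j t
    using that
  proof (induction j)
    case (Suc j)
    have "Suc j * d \<le> l * d" using Suc.prems by (intro mult_le_mono1) simp
    with Suc.prems have "x (p + j * d + t) = x (p + j * d + t + d)"
      by (intro periodic) auto
    with Suc show ?case by (simp add: algebra_simps)
  qed simp
  then have "x [p + l * d \<rightarrow> p + l * d + d] = x [p \<rightarrow> p + d]"
    by (auto simp: list_eq_iff_nth_eq subsequence_def)
  moreover have "x [p \<rightarrow> p + Suc l * d] = x [p \<rightarrow> p + l * d] @ x [p + l * d \<rightarrow> p + l * d + d]"
    by (simp add: subsequence_join algebra_simps)
  moreover have "concat (replicate l (x [p \<rightarrow> p + d])) = x [p \<rightarrow> p + l * d]"
    using Suc by simp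
  ultimately show ?case
    by (simp flip: replicate_append_same)
qed simp

text \<open>From \<open>s\<close>, in block \<open>b\<close> for length \<open>m\<close>, step back
  by \<open>(b - a) * m\<close> into block \<open>a\<close> for \<open>m\<close>. The bounds on
  \<open>s\<close> put this position also in block \<open>a\<close> for length \<open>n\<close>, so
  a step forward by \<open>(b - a) * n\<close> is possible. The net shift is the period.\<close>

lemma period_if_equal_blocks:
  fixes x :: "'a word"
  assumes eq_m: "\<And>t. t < m \<Longrightarrow> x (a * m + t) = x (b * m + t)"
    and eq_n: "\<And>t. t < n \<Longrightarrow> x (a * n + t) = x (b * n + t)"
    and "a < b" "m < n"
    and s: "a * n + (b - a) * m \<le> s" "s < b * m + m"
  shows "x s = x (s + (b - a) * (n - m))"
proof -
  define c e where "c = b - a" and "e = n - m"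
  have b: "b = a + c" and n: "n = m + e" using \<open>a < b\<close> \<open>m < n\<close> by (simp_all add: c_def e_def)
  obtain t where t: "s = a * n + c * m + t" using s(1) le_Suc_ex by (auto simp: c_def)
  have lt: "a * e + t < m" using s(2) by (simp add: t b n algebra_simps)
  have "x s = x (b * m + (a * e + t))" by (simp add: t b n algebra_simps)
  also have "\<dots> = x (a * m + (a * e + t))" using eq_m lt by simp
  also have "\<dots> = x (a * n + t)" by (simp add: n algebra_simps)
  also have "\<dots> = x (b * n + t)" using eq_n lt n by simp
  also have "\<dots> = x (s + c * e)" by (simp add: t b n algebra_simps)
  finally show ?thesis by (simp add: c_def e_def)
qed

lemma power_if_no_anti_power:
  assumes no_anti: "\<nexists>w. factor w x \<and> is_anti_power k w"
  shows "\<exists>w. factor w x \<and> is_power l w"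
proof -
  define P where "P m q \<longleftrightarrow> fst q < snd q \<and> snd q < k \<and>
      (\<forall>t<m. x (fst q * m + t) = x (snd q * m + t))" for m and q :: "nat \<times> nat"
  have "\<exists>q. P m q" if "0 < m" for m
    using equal_blocks_if_no_anti_power [OF no_anti that]
    by (metis P_def fst_conv snd_conv)
  then obtain f where f: "P m (f m)" if "0 < m" for m by metis
  \<comment> \<open>The two summands will bound \<open>a * (n - m)\<close> and \<open>l * d\<close>;
    \<open>Suc\<close> makes the final inequality strict and all block lengths positive.\<close>
  define M where "M = Suc (k ^ 3 + l * k ^ 3)"
  have "f ` {M..M + k ^ 2} \<subseteq> {..<k} \<times> {..<k}"
  proof
    fix q assume "q \<in> f ` {M..M + k ^ 2}"
    then obtain m where "M \<le> m" "q = f m" by auto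
    then have "P m q" using f by (simp add: M_def)
    then have "fst q < k" "snd q < k" by (simp_all add: P_def)
    then show "q \<in> {..<k} \<times> {..<k}" by (simp add: mem_Times_iff)
  qed
  then have "card (f ` {M..M + k ^ 2}) \<le> card ({..<k} \<times> {..<k})"
    by (intro card_mono) auto
  \<comment> \<open>The window has \<open>k ^ 2 + 1\<close> lengths, but there are at most
    \<open>k ^ 2\<close> pairs.\<close>
  then have "\<not> inj_on f {M..M + k ^ 2}"
    by (intro pigeonhole) (simp add: power2_eq_square)
  then obtain m n where mn: "M \<le> m" "m < n" "n \<le> M + k ^ 2" "f m = f n"
    unfolding inj_on_def by (metis atLeastAtMost_iff linorder_neqE_nat)
  obtain a b where q: "f m = (a, b)" by fastforce
  have "P m (a, b)" "P n (a, b)" using f [of m] f [of n] mn q by (auto simp: M_def)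
  then have ab: "a < b" "b < k"
    and eq: "\<And>t. t < m \<Longrightarrow> x (a * m + t) = x (b * m + t)"
      "\<And>t. t < n \<Longrightarrow> x (a * n + t) = x (b * n + t)"
    by (auto simp: P_def)
  define d where "d = (b - a) * (n - m)"
  \<comment> \<open>The overlap of the two blocks with index \<open>a\<close> starts at
    \<open>a * n\<close>; its copy in block \<open>b\<close> for \<open>m\<close> starts at
    \<open>p\<close>.\<close>
  define p where "p = a * n + (b - a) * m"
  have "n - m \<le> k ^ 2" using mn by simp
  then have "a * (n - m) \<le> k * k ^ 2" "d \<le> k * k ^ 2"
    unfolding d_def using ab by (intro mult_le_mono; simp)+
  then have bounds: "a * (n - m) \<le> k ^ 3" "l * d \<le> l * k ^ 3"
    by (simp_all add: power3_eq_cube power2_eq_square)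
  \<comment> \<open>In this form \<open>p\<close> is seen to lie at offset at most
    \<open>k ^ 3\<close> in block \<open>b\<close> for \<open>m\<close>, which leaves more than
    \<open>l * d\<close> letters.\<close>
  have "p = b * m + a * (n - m)"
  proof -
    obtain c e where "b = a + c" "n = m + e" using ab mn by (metis less_imp_add_positive)
    then show ?thesis by (simp add: p_def algebra_simps)
  qed
  then have "p + l * d < b * m + m"
    using bounds mn(1) unfolding M_def by linarith
  then have "x s = x (s + d)" if "p \<le> s" "s < p + l * d" for s
    using period_if_equal_blocks [OF eq ab(1) mn(2), of s] that
    by (simp add: d_def p_def)
  then have "concat (replicate l (x [p \<rightarrow> p + d])) = x [p \<rightarrow> p + l * d]"
    by (rule power_if_periodic)
  moreover have "x [p \<rightarrow> p + d] \<noteq> []"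
    using ab mn by (simp add: d_def subsequence_def)
  ultimately have "is_power l (x [p \<rightarrow> p + l * d])"
    unfolding is_power_def by metis
  moreover have "factor (x [p \<rightarrow> p + l * d]) x"
    unfolding factor_def using le_add1 by blast
  ultimately show ?thesis by blast
qed

theorem theorem1:
  fixes x :: "'a word"
  shows "(\<forall>k\<ge>1. \<exists>w. factor w x \<and> is_power k w) \<or>
         (\<forall>k\<ge>1. \<exists>w. factor w x \<and> is_anti_power k w)"
  using power_if_no_anti_power by blast

end
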